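(* Let $b<c$ be integers of the same parity, and write $\delta=(b-c)^2/4=2^t\Omega^2$ with $t\geq 0$ even and $\Omega\geq 1$ odd. Assume $\sigma_{-1}(\Omega)\leq 4/3$. Let $c^*=\max(1,c+1)$, $f(n)=(n-b)(n-c)$ and $X=\sqrt{f(N)}$. Then for every integer $N\geq c^*$, \[\sum_{c^*\leq n\leq N}\tau\big((n-b)(n-c)\big)< 2N\Big(\frac{3}{\pi^2}\log^2 X+\Big(\frac{6}{\pi^2}+C(\Omega)\Big)\log X+C(\Omega)\Big)+2X\Big(\frac{6}{\pi^2}\log X+C(\Omega)\Big),\] where \[C(\Omega)=2\sum_{d\mid\Omega}\frac1d\Big(2\sigma_0(\Omega/d)-1.749\,\sigma_{-1}(\Omega/d)+1.332\Big).\]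
   Context: $\tau(m)$ is the number of positive divisors of $m$; $\sigma_a(q)=\sum_{d\mid q}d^a$ (sum over positive divisors), so $\sigma_0$ counts divisors and $\sigma_{-1}(q)=\sum_{d\mid q}1/d$. *)

theory Defs
  imports "HOL-Analysis.Analysis"
begin

definition tau :: "nat \<Rightarrow> nat" where
  "tau m = card {d. d dvd m}"

definition sigma :: "real \<Rightarrow> nat \<Rightarrow> real" where
  "sigma a q = (\<Sum>d\<in>{d. d dvd q}. real d powr a)"

definition C_Omega :: "nat \<Rightarrow> real" where
  "C_Omega \<Omega> = 2 * (\<Sum>d\<in>{d. d dvd \<Omega>}. (1 / real d) *
      (2 * sigma 0 (\<Omega> div d) - 1.749 * sigma (-1) (\<Omega> div d) + 1.332))"

end

theory Submission
  imports Defs "HOL-Number_Theory.Number_Theory" "HOL-Computational_Algebra.Squarefree"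
begin

text \<open>
  With \<open>D = c - b = 2\<^sup>K \<Omega>\<close>, pairing each divisor with its cofactor bounds the sum by
  \<open>2 \<Sum>\<^sub>d (N/d + 1) \<rho>(d)\<close>, \<open>d \<le> X\<close>, where \<open>\<rho>(d)\<close> is the number of \<open>m\<close> modulo \<open>d\<close> with \<open>d | m(m + D)\<close>; by Abel
  summation it is enough to show \<open>\<Sum>\<^sub>d \<rho>(d) < x (6/\<pi>\<^sup>2 log x + C(\<Omega>))\<close>, \<open>d \<le> x\<close>. Splitting the solutions \<open>m\<close> according
  to the largest \<open>e\<close> with \<open>e | m\<close>, \<open>e | D\<close>, \<open>e\<^sup>2 | d\<close> bounds \<open>\<rho>(d)\<close> by the sum over these \<open>e\<close> of \<open>e\<close> times the number of
  factorizations \<open>d = e\<^sup>2 q l\<close> with \<open>q\<close> squarefree and \<open>l\<close> coprime to \<open>D/e\<close>. Counting \<open>l\<close> by a sieve produces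
  the main term \<open>\<phi>(D/e)/D\<close>, whose sum over \<open>e\<close> is 1, times \<open>x \<Sum> 1/q \<le> x (6/\<pi>\<^sup>2) (log x + 7/2)\<close>, and the
  sieve errors add up to at most \<open>x \<Sum> \<sigma>\<^sub>0(\<Omega>/e)/e\<close> over \<open>e | \<Omega>\<close>. Since \<open>\<Sum> 1/e \<le> 4/3\<close> over \<open>e | \<Omega>\<close>, the constant \<open>C(\<Omega>)\<close>
  exceeds the total of the secondary terms.
\<close>

subsection \<open>Counting solutions of \<open>d | m(m + D)\<close>\<close>

text \<open>An element is determined by its residue and by the index \<open>(m - M) div d\<close> of
  its block of length \<open>d\<close>. Using \<open>L - 1\<close> makes the block count a ceiling,
  so that a window of exactly \<open>e\<close> periods gives the factor \<open>e\<close>.\<close>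

lemma card_residues_interval_le:
  fixes A T :: "nat set" and M L d :: nat
  assumes "d > 0" "L > 0" "finite T"
    and A: "\<And>m. m \<in> A \<Longrightarrow> M \<le> m \<and> m < M + L \<and> m mod d \<in> T"
  shows "card A \<le> ((L - 1) div d + 1) * card T"
proof -
  let ?f = "\<lambda>m. ((m - M) div d, m mod d)"
  have inj: "inj_on ?f A"
  proof (rule inj_onI)
    fix x y assume xy: "x \<in> A" "y \<in> A" and e: "?f x = ?f y"
    from e have q: "(x - M) div d = (y - M) div d" and r: "[x = y] (mod d)"
      by (auto simp: cong_def)
    have x: "x = M + (x - M)" and y: "y = M + (y - M)" using A[OF xy(1)] A[OF xy(2)] by auto
    have "[M + (x - M) = M + (y - M)] (mod d)" using r x y by simp
    then have "(x - M) mod d = (y - M) mod d" using cong_add_lcancel_nat unfolding cong_def by blast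
    with q have "(x - M) div d * d + (x - M) mod d = (y - M) div d * d + (y - M) mod d" by simp
    then have "x - M = y - M" by (simp only: div_mult_mod_eq)
    with x y show "x = y" by simp
  qed
  have "?f ` A \<subseteq> {..(L - 1) div d} \<times> T"
  proof (clarsimp)
    fix m assume "m \<in> A"
    from A[OF this] have "m - M \<le> L - 1" "m mod d \<in> T" by auto
    then show "(m - M) div d \<le> (L - Suc 0) div d \<and> m mod d \<in> T" by (simp add: div_le_mono)
  qed
  then have "card A \<le> card ({..(L - 1) div d} \<times> T)"
    using inj assms(3) by (intro card_inj_on_le[of ?f]) auto
  then show ?thesis by (simp add: card_cartesian_product)
qed

lemma not_coprime_obtains_prime:
  fixes a b :: nat
  assumes "\<not> coprime a b"
  obtains p where "prime p" "p dvd a" "p dvd b"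
proof -
  have "gcd a b \<noteq> 1" using assms coprime_iff_gcd_eq_1 by blast
  then obtain p where "prime p" "p dvd gcd a b" using prime_factor_nat by blast
  then show ?thesis using that by simp
qed

definition rad :: "nat \<Rightarrow> nat" where
  "rad a = \<Prod>(prime_factors a)"

lemma prime_dvd_rad_iff:
  assumes "a > 0" "prime p" shows "p dvd rad a \<longleftrightarrow> p dvd a"
proof -
  have "p dvd rad a \<longleftrightarrow> (\<exists>x\<in>prime_factors a. p dvd x)"
    unfolding rad_def using assms(2) by (subst prime_dvd_prod_iff) auto
  also have "\<dots> \<longleftrightarrow> p dvd a"
    using assms by (auto simp: in_prime_factors_iff dest: primes_dvd_imp_eq intro!: bexI[of _ p])
  finally show ?thesis .
qed

lemma rad_dvd: assumes "a > 0" shows "rad a dvd a"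
proof -
  have "rad a dvd (\<Prod>p\<in>prime_factors a. p ^ multiplicity p a)"
    unfolding rad_def by (intro prod_dvd_prod dvd_power) (auto simp: prime_factors_multiplicity)
  then show ?thesis using assms by (simp add: prod_prime_factors)
qed

lemma squarefree_prod_primes:
  fixes P :: "nat set"
  assumes "finite P" "\<And>p. p \<in> P \<Longrightarrow> prime p"
  shows "squarefree (\<Prod>P)"
  using assms
  by (intro squarefree_prod_coprime) (auto intro: primes_coprime squarefree_prime)

lemma squarefree_rad: "squarefree (rad a)"
  unfolding rad_def by (rule squarefree_prod_primes) auto

definition rho :: "nat \<Rightarrow> nat \<Rightarrow> nat" where
  "rho D d = card {m. m < d \<and> d dvd m * (m + D)}"

text \<open>Each \<open>q\<close> stands for a factorization \<open>l = q * k\<close> with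
  \<open>k\<close> coprime to \<open>n\<close>, a form whose sum over \<open>l\<close> can be
  bounded by sieving for \<open>k\<close>.\<close>

definition sqfree_coprime_divisors :: "nat \<Rightarrow> nat \<Rightarrow> nat set" where
  "sqfree_coprime_divisors n l = {q. q dvd l \<and> squarefree q \<and> coprime (l div q) n}"

text \<open>A solution \<open>m\<close> splits \<open>l\<close> into coprime factors
  \<open>a = gcd m l\<close> and \<open>l div a\<close>, the first dividing \<open>m\<close> and the
  second \<open>m + n\<close>, so \<open>a\<close> determines \<open>m\<close> modulo
  \<open>l\<close> (Chinese remainder). Being coprime to its cofactor, \<open>a\<close> is in turn
  determined by its radical, which is the \<open>q\<close> counted on the right.\<close>

lemma card_primitive_solutions_le:
  fixes n l :: nat
  assumes l: "l > 0"
  shows "card {m. m < l \<and> l dvd m * (m + n) \<and> (\<forall>p. prime p \<longrightarrow> p dvd m \<longrightarrow> p dvd n \<longrightarrow> \<not> p\<^sup>2 dvd l)}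
    \<le> card (sqfree_coprime_divisors n l)" (is "card ?Z \<le> _")
proof (rule card_inj_on_le[where f = "\<lambda>m. rad (gcd m l)"])
  have gp: "gcd m l > 0" for m using l by simp
  have dv: "l div gcd m l dvd m + n" and cop: "coprime (gcd m l) (l div gcd m l)"
    and lg: "l = gcd m l * (l div gcd m l)"
    if m: "m \<in> ?Z" for m
  proof -
    let ?a = "gcd m l"
    show lg: "l = ?a * (l div ?a)" by simp
    have "?a * ((m div ?a) * (m + n)) = m * (m + n)" by (simp flip: mult.assoc)
    moreover have "l dvd m * (m + n)" using m by blast
    ultimately have "?a * (l div ?a) dvd ?a * ((m div ?a) * (m + n))"
      by (simp only: dvd_mult_div_cancel[OF gcd_dvd2])
    then have "l div ?a dvd (m div ?a) * (m + n)" 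
      using l by (subst (asm) dvd_times_left_cancel_iff) auto
    moreover have "coprime (l div ?a) (m div ?a)"
      using div_gcd_coprime[of m l] l by (simp add: coprime_commute)
    ultimately show d: "l div ?a dvd m + n" by (simp add: coprime_dvd_mult_right_iff)
    show "coprime ?a (l div ?a)"
    proof (rule ccontr)
      assume "\<not> coprime ?a (l div ?a)"
      then obtain p where p: "prime p" "p dvd ?a" "p dvd l div ?a"
        by (rule not_coprime_obtains_prime)
      have "p * p dvd ?a * (l div ?a)" using p by (intro mult_dvd_mono)
      then have "p * p dvd l" by simp
      moreover have "p dvd m" using p by simp
      moreover have "p dvd n" using p dvd_trans[OF p(3) d] \<open>p dvd m\<close> by (simp add: dvd_add_right_iff)
      ultimately show False using m p by (auto simp: power2_eq_square)
    qed
  qed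
  show "inj_on (\<lambda>m. rad (gcd m l)) ?Z"
  proof (rule inj_onI)
    fix x y assume x: "x \<in> ?Z" and y: "y \<in> ?Z" and e: "rad (gcd x l) = rad (gcd y l)"
    \<comment> \<open>A prime shared by \<open>gcd u l\<close> and the cofactor of
      \<open>gcd v l\<close> would also divide \<open>gcd v l\<close>, as the radicals agree,
      against coprimality.\<close>
    have *: "gcd u l dvd gcd v l" if u: "u \<in> ?Z" and v: "v \<in> ?Z" and e: "rad (gcd u l) = rad (gcd v l)" for u v
    proof -
      have "coprime (gcd u l) (l div gcd v l)"
      proof (rule ccontr)
        assume "\<not> ?thesis"
        then obtain p where p: "prime p" "p dvd gcd u l" "p dvd l div gcd v l"
          by (rule not_coprime_obtains_prime)
        then have "p dvd gcd v l" using e prime_dvd_rad_iff[OF gp] by metis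
        then show False using coprime_common_divisor[OF cop[OF v]] p not_prime_unit by blast
      qed
      moreover have "gcd u l dvd gcd v l * (l div gcd v l)" by simp
      ultimately show ?thesis using coprime_dvd_mult_left_iff by blast
    qed
    have eq: "gcd x l = gcd y l" using *[OF x y e] *[OF y x e[symmetric]] by (rule dvd_antisym)
    let ?a = "gcd x l"
    have "[x = y] (mod ?a)" 
    proof -
      have "?a dvd x" by simp
      moreover have "?a dvd y" unfolding eq by simp
      ultimately
      show ?thesis by (simp add: cong_def)
    qed
    moreover have "[x + n = y + n] (mod (l div ?a))"
      using dv[OF x] dv[OF y, folded eq] by (simp add: cong_def)
    then have "[x = y] (mod (l div ?a))" by (simp add: cong_add_rcancel_nat)
    ultimately have "[x = y] (mod (?a * (l div ?a)))"
      using cop[OF x] by (intro coprime_cong_mult_nat) auto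
    then show "x = y" using x y cong_less_modulus_unique_nat[of x y l] by simp
  qed
  show "(\<lambda>m. rad (gcd m l)) ` ?Z \<subseteq> sqfree_coprime_divisors n l"
  proof
    fix q assume "q \<in> (\<lambda>m. rad (gcd m l)) ` ?Z"
    then obtain m where m: "m \<in> ?Z" and q: "q = rad (gcd m l)" by blast
    have ql: "q dvd l" using q rad_dvd[OF gp] by (metis dvd_trans gcd_dvd2)
    \<comment> \<open>A prime \<open>p\<close> dividing both would divide \<open>m\<close>, hence
      also \<open>q\<close>, so that \<open>p\<^sup>2\<close> divides \<open>l\<close>; the last
      condition on \<open>m\<close> excludes this.\<close>
    have "coprime (l div q) n"
    proof (rule ccontr)
      assume "\<not> ?thesis"
      then obtain p where p: "prime p" "p dvd l div q" "p dvd n"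
        by (rule not_coprime_obtains_prime)
      have pl: "p dvd l" using dvd_mult[OF p(2), of q] ql by simp
      have pm: "p dvd m"
      proof (cases "p dvd gcd m l")
        case False
        moreover have "p dvd gcd m l * (l div gcd m l)" using pl by simp
        ultimately have "p dvd l div gcd m l" using p(1) prime_dvd_mult_iff by blast
        then have "p dvd m + n" using dv[OF m] by (rule dvd_trans)
        then show ?thesis using p by (simp add: dvd_add_left_iff)
      qed simp
      then have "p dvd q" using q pl gp p(1) by (simp add: prime_dvd_rad_iff)
      then have "p * p dvd q * (l div q)" using p by (intro mult_dvd_mono)
      then have "p\<^sup>2 dvd l" using ql by (simp add: power2_eq_square)
      with m pm p show False by auto
    qed
    then show "q \<in> sqfree_coprime_divisors n l"
      using q ql squarefree_rad by (simp add: sqfree_coprime_divisors_def)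
  qed
  show "finite (sqfree_coprime_divisors n l)"
    unfolding sqfree_coprime_divisors_def by (rule finite_subset[OF _ finite_divisors_nat[OF l]]) auto
qed

text \<open>If \<open>e\<close> is the largest admissible divisor of \<open>m\<close>, then
  \<open>m div e\<close> is a primitive solution for \<open>D div e\<close> modulo
  \<open>d div e\<^sup>2\<close>, since an offending prime \<open>p\<close> would make
  \<open>e * p\<close> admissible. The quotient ranges below \<open>d div e\<close>, where every
  residue modulo \<open>d div e\<^sup>2\<close> occurs \<open>e\<close> times; hence the weight
  \<open>e\<close>.\<close>

lemma rho_le:
  fixes D d :: nat
  assumes D: "D > 0" and d: "d > 0"
  shows "rho D d \<le> (\<Sum>e | e dvd D \<and> e\<^sup>2 dvd d. e * card (sqfree_coprime_divisors (D div e) (d div e\<^sup>2)))"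
proof -
  define E where "E = {e. e dvd D \<and> e\<^sup>2 dvd d}"
  have finE: "finite E" unfolding E_def by (rule finite_subset[OF _ finite_divisors_nat[OF D]]) auto
  define P where "P n l = {m. m < l \<and> l dvd m * (m + n) \<and> (\<forall>p. prime p \<longrightarrow> p dvd m \<longrightarrow> p dvd n \<longrightarrow> \<not> p\<^sup>2 dvd l)}" for n l :: nat
  define B where "B e = {m'. m' < e * (d div e\<^sup>2) \<and> m' mod (d div e\<^sup>2) \<in> P (D div e) (d div e\<^sup>2)}" for e
  have sub: "{m. m < d \<and> d dvd m * (m + D)} \<subseteq> (\<Union>e\<in>E. (\<lambda>m. e * m) ` B e)"
  proof
    fix m assume "m \<in> {m. m < d \<and> d dvd m * (m + D)}"
    then have m: "m < d" "d dvd m * (m + D)" by auto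
    define F where "F = {e\<in>E. e dvd m}"
    have "finite F" using finE by (simp add: F_def)
    have "1 \<in> F" by (simp add: F_def E_def)
    define e where "e = Max F"
    have eF: "e \<in> F" using \<open>finite F\<close> \<open>1 \<in> F\<close> unfolding e_def by (metis Max_in empty_iff)
    have emax: "x \<le> e" if "x \<in> F" for x using that \<open>finite F\<close> unfolding e_def by simp
    have e0: "e > 0" using eF D by (auto simp: F_def E_def)
    define l where "l = d div e\<^sup>2"
    define m' where "m' = m div e"
    define n where "n = D div e"
    have dl: "d = e\<^sup>2 * l" and mm: "m = e * m'" and Dn: "D = e * n" and eE: "e \<in> E"
      using eF by (auto simp: F_def E_def l_def m'_def n_def)
    have l0: "l > 0" using d dl by (auto intro: gr0I)
    have "e\<^sup>2 * l dvd e\<^sup>2 * (m' * (m' + n))"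
      using m(2) unfolding dl mm Dn by (simp add: power2_eq_square algebra_simps)
    then have ld: "l dvd m' * (m' + n)" using e0 by simp
    have np: "\<not> p\<^sup>2 dvd l" if p: "prime p" "p dvd m'" "p dvd n" for p
    proof
      assume "p\<^sup>2 dvd l"
      then have "e * p \<in> F" using p by (auto simp: F_def E_def dl mm Dn power_mult_distrib)
      then have "e * p \<le> e" by (rule emax)
      with e0 prime_gt_1_nat[OF p(1)] show False by simp
    qed
    \<comment> \<open>Primitivity passes from \<open>m'\<close> to its residue because it only
      concerns primes dividing \<open>l\<close>.\<close>
    have pm: "p dvd m' mod l \<longleftrightarrow> p dvd m'" if "p\<^sup>2 dvd l" for p
    proof -
      have "p dvd l" using that by (metis dvd_triv_left dvd_trans power2_eq_square)
      then show ?thesis by (rule dvd_mod_iff)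
    qed
    have "l dvd (m' mod l) * (m' mod l + n)"
    proof -
      have "[(m' mod l) * (m' mod l + n) = m' * (m' + n)] (mod l)"
        by (intro cong_mult cong_add) auto
      then show ?thesis using ld cong_dvd_iff[of _ _ l] by blast
    qed
    then have "m' mod l \<in> P n l" using np pm l0 by (auto simp: P_def)
    moreover have "m' < e * l" using m(1) e0 unfolding dl mm by (simp add: power2_eq_square)
    ultimately have "m' \<in> B e" by (simp add: B_def l_def n_def)
    then show "m \<in> (\<Union>e\<in>E. (\<lambda>m. e * m) ` B e)" using mm eE by blast
  qed
  have finB: "finite (B e)" for e by (simp add: B_def)
  have "rho D d \<le> card (\<Union>e\<in>E. (\<lambda>m. e * m) ` B e)"
    unfolding rho_def using sub finE finB by (intro card_mono) auto
  also have "\<dots> \<le> (\<Sum>e\<in>E. card ((\<lambda>m. e * m) ` B e))"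
    using finE by (rule card_UN_le)
  also have "\<dots> \<le> (\<Sum>e\<in>E. e * card (sqfree_coprime_divisors (D div e) (d div e\<^sup>2)))"
  proof (rule sum_mono)
    fix e assume e: "e \<in> E"
    let ?l = "d div e\<^sup>2"
    have e0: "e > 0" using e D by (auto simp: E_def)
    have l0: "?l > 0" using e d by (auto simp: E_def elim!: dvdE)
    have Pf: "finite (P (D div e) ?l)" by (simp add: P_def)
    have "card ((\<lambda>m. e * m) ` B e) \<le> card (B e)" using finB by (rule card_image_le)
    also have "\<dots> \<le> ((e * ?l - 1) div ?l + 1) * card (P (D div e) ?l)"
      using l0 e0 Pf by (intro card_residues_interval_le[where M = 0]) (auto simp: B_def)
    also have "(e * ?l - 1) div ?l + 1 = e"
    proof -
      have "(e * ?l - 1) div ?l < e" using e0 l0 by (subst div_less_iff_less_mult) auto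
      moreover have "e - 1 \<le> (e * ?l - 1) div ?l"
        using e0 l0 by (subst less_eq_div_iff_mult_less_eq) (auto simp: diff_mult_distrib diff_le_mono2)
      ultimately show ?thesis by simp
    qed
    also have "card (P (D div e) ?l) \<le> card (sqfree_coprime_divisors (D div e) ?l)"
      unfolding P_def using l0 by (rule card_primitive_solutions_le)
    finally show "card ((\<lambda>m. e * m) ` B e) \<le> e * card (sqfree_coprime_divisors (D div e) ?l)"
      by simp
  qed
  finally show ?thesis by (simp add: E_def)
qed

subsection \<open>Reciprocals of squarefree numbers\<close>

text \<open>Induction from \<open>n = 2\<close>, where \<open>3/2 - 2/3 = 5/6\<close> and
  \<open>ln 2 \<ge> 2/3\<close>; the constant would be too small at \<open>n = 1\<close>.\<close>

lemma harmonic_sum_le: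
  fixes n :: nat assumes "n \<ge> 2"
  shows "(\<Sum>k=1..n. 1 / real k) \<le> ln (real n) + 5/6"
  using assms
proof (induction n rule: dec_induct)
  case base
  have "{1..2::nat} = {1,2}" by auto
  then show ?case using ln2_ge_two_thirds by simp
next
  case (step n)
  have "ln (real n / real (Suc n)) \<le> real n / real (Suc n) - 1"
    using step.hyps by (intro ln_le_minus_one) auto
  then have "1 / real (Suc n) \<le> ln (real (Suc n)) - ln (real n)"
    using step.hyps by (simp add: ln_div field_simps)
  then show ?case using step.IH by simp
qed

lemma sum_inverse_sqrt_le:
  fixes n :: nat shows "(\<Sum>k=1..n. 1 / sqrt (real k)) \<le> 2 * sqrt (real n)"
proof (induction n)
  case (Suc n)
  have "sqrt (real n) * sqrt (real (Suc n)) \<le> real n + 1/2"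
    by (rule power2_le_imp_le) (auto simp: power_mult_distrib power2_eq_square algebra_simps)
  then have "1 / sqrt (real (Suc n)) \<le> 2 * sqrt (real (Suc n)) - 2 * sqrt (real n)"
    by (simp add: field_simps)
  then show ?case using Suc by simp
qed simp

text \<open>The telescoping bound \<open>1/u\<^sup>2 \<le> 1/(u - 1/2) - 1/(u + 1/2)\<close> shows
  that the right side does not increase with \<open>z\<close>, and it always exceeds the partial
  sum.\<close>

lemma basel_tail_le:
  fixes z :: nat
  shows "pi\<^sup>2 / 6 \<le> (\<Sum>s=1..z. 1 / (real s)\<^sup>2) + 1 / (real z + 1/2)"
proof -
  let ?g = "\<lambda>n. (\<Sum>s=1..n. 1 / (real s)\<^sup>2) + 1 / (real n + 1/2)"
  have dec: "?g n \<le> ?g z" if "z \<le> n" for n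
    using that
  proof (induction n rule: dec_induct)
    case (step n)
    let ?u = "real (Suc n)"
    have "(?u - 1/2) * (?u + 1/2) > 0" by (intro mult_pos_pos) auto
    moreover have "(?u - 1/2) * (?u + 1/2) \<le> ?u\<^sup>2"
      by (simp add: algebra_simps power2_eq_square)
    ultimately have "1 / ?u\<^sup>2 \<le> 1 / ((?u - 1/2) * (?u + 1/2))"
      by (intro frac_le) auto
    also have "\<dots> = 1 / (?u - 1/2) - 1 / (?u + 1/2)"
      by (simp add: divide_simps)
    finally have "1 / ?u\<^sup>2 \<le> 1 / (real n + 1/2) - 1 / (?u + 1/2)"
      by (simp add: add.commute)
    then show ?case using step.IH by simp
  qed simp
  have "(\<lambda>n. \<Sum>k<n. 1 / (real k + 1)\<^sup>2) \<longlonglongrightarrow> pi\<^sup>2 / 6"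
    using inverse_squares_sums by (simp add: sums_def add_ac)
  moreover have "(\<Sum>k<n. 1 / (real k + 1)\<^sup>2) = (\<Sum>s=1..n. 1 / (real s)\<^sup>2)" for n
    by (induction n) (auto simp: add_ac)
  ultimately have lim: "(\<lambda>n. \<Sum>s=1..n. 1 / (real s)\<^sup>2) \<longlonglongrightarrow> pi\<^sup>2 / 6" by simp
  show ?thesis
  proof (rule LIMSEQ_le_const2[OF lim], intro exI allI impI)
    fix n assume "z \<le> n"
    have "(\<Sum>s=1..n. 1 / (real s)\<^sup>2) \<le> ?g n" by simp
    also have "\<dots> \<le> ?g z" using dec[OF \<open>z \<le> n\<close>] .
    finally show "(\<Sum>s=1..n. 1 / (real s)\<^sup>2) \<le> ?g z" .
  qed
qed

text \<open>If the square part is \<open>s * k\<close>, then \<open>k\<^sup>2\<close> divides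
  \<open>q\<close>, so \<open>k = 1\<close>. Thus \<open>s\<close>, and then \<open>q\<close>, can
  be recovered from \<open>q * s\<^sup>2\<close>.\<close>

lemma square_part_squarefree_mult:
  fixes q s :: nat
  assumes "squarefree q" "s > 0"
  shows "square_part (q * s\<^sup>2) = s"
proof -
  let ?t = "square_part (q * s\<^sup>2)"
  have "s dvd ?t" by (simp add: dvd_square_part_iff)
  then obtain k where k: "?t = s * k" by (elim dvdE)
  have "?t\<^sup>2 dvd q * s\<^sup>2" by (rule square_part_square_dvd)
  then have "s\<^sup>2 * k\<^sup>2 dvd s\<^sup>2 * q" by (simp only: k power_mult_distrib mult.commute)
  then have "k\<^sup>2 dvd q" using assms(2) by simp
  then have "k = 1" using assms(1) by (metis nat_dvd_1_iff_1 squarefreeD)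
  with k show ?thesis by simp
qed

lemma inj_on_squarefree_decomposition:
  "inj_on (\<lambda>(q, s). q * s\<^sup>2) {(q, s :: nat). squarefree q \<and> s > 0}"
proof (rule inj_onI, clarsimp)
  fix q s q' s' :: nat
  assume a: "squarefree q" "0 < s" "squarefree q'" "0 < s'" "q * s\<^sup>2 = q' * s'\<^sup>2"
  then have "s = s'" by (metis square_part_squarefree_mult)
  with a show "q = q' \<and> s = s'" by simp
qed

definition sqfree_upto :: "nat \<Rightarrow> nat set" where
  "sqfree_upto x = {q \<in> {1..x}. squarefree q}"

lemma finite_sqfree_upto [simp]: "finite (sqfree_upto x)"
  by (simp add: sqfree_upto_def)

text \<open>Multiplying the sum by \<open>\<zeta>(2) = \<Sum>1/s\<^sup>2\<close> turns it into a sum of \<open>1/(q s\<^sup>2)\<close>; the terms with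
  \<open>q s\<^sup>2 \<le> x\<close> make up the harmonic sum, and the rest is controlled by the tail of \<open>\<zeta>(2)\<close>.\<close>
lemma sum_inverse_squarefree_le:
  fixes x :: nat assumes x: "x \<ge> 1"
  shows "(\<Sum>q\<in>sqfree_upto x. 1 / real q) \<le> 6 / pi\<^sup>2 * (ln (real x) + 7/2)"
proof -
  let ?S = "sqfree_upto x"
  \<comment> \<open>The largest \<open>s\<close> with \<open>q * s\<^sup>2 \<le> x\<close>.\<close>
  define z where "z q = nat \<lfloor>sqrt (real x / real q)\<rfloor>" for q
  have z1: "z q \<ge> 1" and zle: "q * (z q)\<^sup>2 \<le> x"
    and zb: "1 / (real (z q) + 1/2) \<le> 4/3 * (sqrt (real q) / sqrt (real x))" if "q \<in> ?S" for q
  proof -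
    have q: "1 \<le> q" "q \<le> x" using that by (auto simp: sqfree_upto_def)
    let ?r = "sqrt (real x / real q)"
    have r1: "?r \<ge> 1" using q by simp
    then show z1: "z q \<ge> 1" by (simp add: z_def le_nat_iff)
    have "real (z q) \<le> ?r" using r1 by (simp add: z_def)
    then have "(real (z q))\<^sup>2 \<le> ?r\<^sup>2" by (intro power_mono) auto
    then have "real (q * (z q)\<^sup>2) \<le> real x" using q by (simp add: field_simps)
    then show "q * (z q)\<^sup>2 \<le> x" by (simp only: of_nat_le_iff)
    have "?r < real (z q) + 1" using r1 unfolding z_def by linarith
    \<comment> \<open>Here \<open>z q \<ge> 1\<close> produces the factor 4/3, with equality at
      \<open>z q = 1\<close>.\<close>
    also have "real (z q) + 1 \<le> 4/3 * (real (z q) + 1/2)" using z1 by simp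
    finally have "3/4 * ?r \<le> real (z q) + 1/2" by simp
    then have "1 / (real (z q) + 1/2) \<le> 1 / (3/4 * ?r)"
      using r1 by (intro divide_left_mono mult_pos_pos) auto
    also have "\<dots> = 4/3 * (sqrt (real q) / sqrt (real x))" by (simp add: real_sqrt_divide)
    finally show "1 / (real (z q) + 1/2) \<le> 4/3 * (sqrt (real q) / sqrt (real x))" .
  qed
  have double: "(\<Sum>q\<in>?S. \<Sum>s=1..z q. 1 / (real q * (real s)\<^sup>2)) \<le> (\<Sum>j=1..x. 1 / real j)"
  proof -
    let ?f = "\<lambda>(q, s). q * s\<^sup>2 :: nat" and ?T = "SIGMA q:?S. {1..z q}"
    have inj: "inj_on ?f ?T"
      by (rule inj_on_subset[OF inj_on_squarefree_decomposition]) (auto simp: sqfree_upto_def)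
    have "(\<Sum>q\<in>?S. \<Sum>s=1..z q. 1 / (real q * (real s)\<^sup>2)) = (\<Sum>p\<in>?T. 1 / real (?f p))"
      by (subst sum.Sigma) (auto intro!: sum.cong)
    also have "\<dots> = (\<Sum>j\<in>?f ` ?T. 1 / real j)"
      by (subst sum.reindex[OF inj]) simp
    also have "\<dots> \<le> (\<Sum>j=1..x. 1 / real j)"
    proof (rule sum_mono2)
      show "?f ` ?T \<subseteq> {1..x}"
      proof
        fix j assume "j \<in> ?f ` ?T"
        then obtain q s where j: "j = q * s\<^sup>2" and qs: "q \<in> ?S" "1 \<le> s" "s \<le> z q" by auto
        then have "q * s\<^sup>2 \<le> q * (z q)\<^sup>2" by (intro mult_left_mono power_mono) auto
        moreover have "q * s\<^sup>2 > 0" using qs by (auto simp: sqfree_upto_def)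
        ultimately have "1 \<le> j" "j \<le> x" using zle[OF qs(1)] unfolding j by linarith+
        then show "j \<in> {1..x}" by simp
      qed
    qed auto
    finally show ?thesis .
  qed
  have "pi\<^sup>2 / 6 * (\<Sum>q\<in>?S. 1 / real q) = (\<Sum>q\<in>?S. pi\<^sup>2 / 6 * (1 / real q))"
    by (rule sum_distrib_left)
  also have "\<dots> \<le> (\<Sum>q\<in>?S. (\<Sum>s=1..z q. 1 / (real q * (real s)\<^sup>2)) + 4/3 / sqrt (real x) * (1 / sqrt (real q)))"
  proof (rule sum_mono)
    fix q assume q: "q \<in> ?S"
    then have q0: "real q > 0" by (auto simp: sqfree_upto_def)
    have "pi\<^sup>2 / 6 * (1 / real q) \<le> ((\<Sum>s=1..z q. 1 / (real s)\<^sup>2) + 1 / (real (z q) + 1/2)) * (1 / real q)"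
      by (rule mult_right_mono[OF basel_tail_le]) simp
    also have "\<dots> \<le> ((\<Sum>s=1..z q. 1 / (real s)\<^sup>2) + 4/3 * (sqrt (real q) / sqrt (real x))) * (1 / real q)"
      by (intro mult_right_mono add_left_mono zb q) simp
    also have "\<dots> = (\<Sum>s=1..z q. 1 / (real q * (real s)\<^sup>2)) + 4/3 / sqrt (real x) * (sqrt (real q) / real q)"
      by (simp add: add_divide_distrib sum_divide_distrib mult_ac)
    also have "sqrt (real q) / real q = 1 / sqrt (real q)"
      using q0 by (simp add: field_simps)
    finally show "pi\<^sup>2 / 6 * (1 / real q)
      \<le> (\<Sum>s=1..z q. 1 / (real q * (real s)\<^sup>2)) + 4/3 / sqrt (real x) * (1 / sqrt (real q))" .
  qed
  also have "\<dots> = (\<Sum>q\<in>?S. \<Sum>s=1..z q. 1 / (real q * (real s)\<^sup>2)) + 4/3 / sqrt (real x) * (\<Sum>q\<in>?S. 1 / sqrt (real q))"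
    by (simp add: sum.distrib sum_distrib_left)
  also have "\<dots> \<le> (\<Sum>j=1..x. 1 / real j) + 4/3 / sqrt (real x) * (2 * sqrt (real x))"
  proof (intro add_mono double mult_left_mono)
    have "(\<Sum>q\<in>?S. 1 / sqrt (real q)) \<le> (\<Sum>q=1..x. 1 / sqrt (real q))"
      by (rule sum_mono2) (auto simp: sqfree_upto_def)
    also have "\<dots> \<le> 2 * sqrt (real x)" by (rule sum_inverse_sqrt_le)
    finally show "(\<Sum>q\<in>?S. 1 / sqrt (real q)) \<le> 2 * sqrt (real x)" .
  qed simp
  also have "4/3 / sqrt (real x) * (2 * sqrt (real x)) = 8/3" using x by simp
  finally have main: "pi\<^sup>2 / 6 * (\<Sum>q\<in>?S. 1 / real q) \<le> (\<Sum>j=1..x. 1 / real j) + 8/3" .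
  have "pi\<^sup>2 / 6 * (\<Sum>q\<in>?S. 1 / real q) \<le> ln (real x) + 7/2"
  \<comment> \<open>The harmonic bound starts at 2 and gives \<open>5/6 + 8/3 = 7/2\<close>. For
    \<open>x = 1\<close> the crude \<open>pi\<^sup>2 / 6 \<le> 16/6\<close> is enough.\<close>
  proof (cases "x = 1")
    case True
    have "?S = {1}" using True by (auto simp: sqfree_upto_def)
    moreover have "pi\<^sup>2 \<le> 4\<^sup>2" using pi_less_4 by (intro power_mono) auto
    ultimately show ?thesis using True by simp
  next
    case False
    then show ?thesis using main harmonic_sum_le[of x] x by simp
  qed
  then show ?thesis by (simp add: field_simps)
qed

subsection \<open>Sieving by finitely many primes\<close>

text \<open>The bound \<open>y\<close> is real because removing a prime \<open>p\<close> replaces it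
  by \<open>y / p\<close>.\<close>

definition sieve_count :: "nat set \<Rightarrow> real \<Rightarrow> nat" where
  "sieve_count P y = card {l. 1 \<le> l \<and> real l \<le> y \<and> (\<forall>p\<in>P. \<not> p dvd l)}"

lemma finite_nat_real_le: "finite {l. 1 \<le> l \<and> real l \<le> y \<and> R l}"
proof (rule finite_subset)
  show "{l. 1 \<le> l \<and> real l \<le> y \<and> R l} \<subseteq> {..nat \<lfloor>y\<rfloor>}" by (auto simp: le_nat_floor)
qed simp

text \<open>Legendre's recursion: the numbers lost are the \<open>p * k\<close> with
  \<open>k \<le> y / p\<close>, and \<open>k\<close> avoids \<open>P\<close> exactly when
  \<open>p * k\<close> does, as \<open>p\<close> is not in \<open>P\<close>.\<close>

lemma sieve_count_insert:
  assumes P: "\<And>q. q \<in> P \<Longrightarrow> prime q" and p: "prime p" "p \<notin> P"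
  shows "real (sieve_count (insert p P) y) = real (sieve_count P y) - real (sieve_count P (y / real p))"
proof -
  have p0: "p > 0" using p(1) by (rule prime_gt_0_nat)
  let ?A = "\<lambda>y. {l. 1 \<le> l \<and> real l \<le> y \<and> (\<forall>q\<in>P. \<not> q dvd l)}"
  let ?B = "{l. 1 \<le> l \<and> real l \<le> y \<and> (\<forall>q\<in>insert p P. \<not> q dvd l)}"
  have pq: "q dvd p * l \<longleftrightarrow> q dvd l" if "q \<in> P" for q l
    using P[OF that] p that prime_dvd_mult_iff[of q p l] primes_dvd_imp_eq[of q p] by blast
  have "?A y = ?B \<union> (\<lambda>l. p * l) ` ?A (y / real p)"
  proof (intro equalityI subsetI)
    fix l assume l: "l \<in> ?A y"
    show "l \<in> ?B \<union> (\<lambda>l. p * l) ` ?A (y / real p)"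
    proof (cases "p dvd l")
      case True
      then obtain k where k: "l = p * k" by (elim dvdE)
      then have "k \<in> ?A (y / real p)" using l p0 pq by (auto simp: field_simps)
      with k show ?thesis by blast
    qed (use l in auto)
  qed (use p0 pq in \<open>auto simp: field_simps\<close>)
  moreover have "?B \<inter> (\<lambda>l. p * l) ` ?A (y / real p) = {}" by auto
  ultimately have "card (?A y) = card ?B + card ((\<lambda>l. p * l) ` ?A (y / real p))"
    using card_Un_disjoint[of ?B "(\<lambda>l. p * l) ` ?A (y / real p)"]
    by (simp only: finite_imageI finite_nat_real_le)
  also have "card ((\<lambda>l. p * l) ` ?A (y / real p)) = card (?A (y / real p))"
    using p0 by (intro card_image inj_onI) auto
  finally show ?thesis by (simp add: sieve_count_def)
qed

lemma sieve_count_empty: "y \<ge> 0 \<Longrightarrow> real (sieve_count {} y) = of_int \<lfloor>y\<rfloor>"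
proof -
  assume "y \<ge> 0"
  then have "{l. 1 \<le> l \<and> real l \<le> y \<and> (\<forall>p\<in>{}. \<not> p dvd l)} = {1..nat \<lfloor>y\<rfloor>}"
    by (auto simp: le_nat_floor) linarith
  then show ?thesis using \<open>y \<ge> 0\<close> by (simp add: sieve_count_def)
qed

text \<open>Each new prime subtracts two sieve counts, so it doubles the error and multiplies the
  density by \<open>1 - 1 / p\<close>. A general starting set \<open>P\<close> allows a start from
  \<open>{2}\<close>, whose error is better than the one obtained by doubling.\<close>

lemma sieve_count_error_union:
  assumes P: "\<And>q. q \<in> P \<Longrightarrow> prime q"
    and B: "\<And>y. y \<ge> 0 \<Longrightarrow> \<bar>real (sieve_count P y) - y * Q\<bar> \<le> B"
    and R: "finite R" "\<And>q. q \<in> R \<Longrightarrow> prime q" "R \<inter> P = {}"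
    and y: "y \<ge> 0"
  shows "\<bar>real (sieve_count (R \<union> P) y) - y * (Q * (\<Prod>p\<in>R. 1 - 1 / real p))\<bar> \<le> B * 2 ^ card R"
  using R y
proof (induction R arbitrary: y rule: finite_induct)
  case empty
  then show ?case using B by simp
next
  case (insert p R)
  let ?Q = "Q * (\<Prod>p\<in>R. 1 - 1 / real p)"
  have pr: "prime p" "p > 0" using insert.prems prime_gt_0_nat by auto
  have eq: "real (sieve_count (insert p (R \<union> P)) y)
      = real (sieve_count (R \<union> P) y) - real (sieve_count (R \<union> P) (y / real p))"
    using insert P by (intro sieve_count_insert) auto
  have 1: "\<bar>real (sieve_count (R \<union> P) y) - y * ?Q\<bar> \<le> B * 2 ^ card R"
    using insert by (intro insert.IH) auto
  have 2: "\<bar>real (sieve_count (R \<union> P) (y / real p)) - y / real p * ?Q\<bar> \<le> B * 2 ^ card R"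
    using insert by (intro insert.IH) auto
  have "y * (Q * (\<Prod>p\<in>insert p R. 1 - 1 / real p)) = y * ?Q - y / real p * ?Q"
    using insert by (simp add: field_simps)
  moreover have "B * 2 ^ card (insert p R) = B * 2 ^ card R + B * 2 ^ card R"
    using insert by simp
  moreover have "\<bar>a - c - (u - v)\<bar> \<le> b + b" if "\<bar>a - u\<bar> \<le> b" "\<bar>c - v\<bar> \<le> b" for a b c u v :: real
    using that by linarith
  from this[OF 1 2] show ?case
    unfolding Un_insert_left eq calculation .
qed

text \<open>The odd numbers up to \<open>y\<close> number
  \<open>\<lfloor>y\<rfloor> - \<lfloor>y / 2\<rfloor>\<close>, and the parity of
  \<open>\<lfloor>y\<rfloor>\<close> decides whether \<open>y / 2\<close> is over- or
  underestimated.\<close>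

lemma sieve_count_error_two:
  assumes "y \<ge> 0" shows "\<bar>real (sieve_count {2} y) - y * (1/2)\<bar> \<le> 1/2"
proof -
  have "real (sieve_count {2} y) = of_int \<lfloor>y\<rfloor> - of_int \<lfloor>y / 2\<rfloor>"
    using sieve_count_insert[of "{}" 2 y] assms by (simp add: sieve_count_empty)
  also have "\<dots> = of_int (\<lfloor>y\<rfloor> - \<lfloor>y / 2\<rfloor>)" by simp
  finally have e: "real (sieve_count {2} y) = of_int (\<lfloor>y\<rfloor> - \<lfloor>y / 2\<rfloor>)" .
  define k where "k = \<lfloor>y / 2\<rfloor>"
  have k: "of_int k \<le> y / 2" "y / 2 < of_int k + 1" unfolding k_def by linarith+
  show ?thesis
  proof (cases "y < 2 * of_int k + 1")
    case True
    then have "\<lfloor>y\<rfloor> = 2 * k" using k by (intro floor_unique) auto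
    then show ?thesis using e k True by (simp add: k_def[symmetric])
  next
    case False
    then have "\<lfloor>y\<rfloor> = 2 * k + 1" using k by (intro floor_unique) auto
    then show ?thesis using e k False by (simp add: k_def[symmetric])
  qed
qed

text \<open>Distinct sets of prime factors have distinct products, all dividing
  \<open>m\<close>.\<close>

lemma two_power_card_prime_factors_le:
  fixes m :: nat assumes m: "m > 0"
  shows "2 ^ card (prime_factors m) \<le> card {d. d dvd m}"
proof -
  have fin: "finite S" if "S \<subseteq> prime_factors m" for S
    by (rule finite_subset[OF that]) simp
  have pr: "prime p" if "S \<subseteq> prime_factors m" "p \<in> S" for S p
    using that by auto
  have dvd_iff: "p dvd \<Prod>S \<longleftrightarrow> p \<in> S" if S: "S \<subseteq> prime_factors m" and p: "prime p" for S p
  proof -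
    have "p dvd \<Prod>S \<longleftrightarrow> (\<exists>x\<in>S. p dvd x)" using fin[OF S] p by (subst prime_dvd_prod_iff) auto
    also have "\<dots> \<longleftrightarrow> p \<in> S"
      using primes_dvd_imp_eq[OF p pr[OF S]] by (auto intro!: bexI[of _ p])
    finally show ?thesis .
  qed
  have "card (Pow (prime_factors m)) \<le> card {d. d dvd m}"
  proof (rule card_inj_on_le[where f = "\<lambda>S. \<Prod>S"])
    show "inj_on Prod (Pow (prime_factors m))"
    proof (rule inj_onI)
      fix S T assume S: "S \<in> Pow (prime_factors m)" and T: "T \<in> Pow (prime_factors m)" and e: "\<Prod>S = \<Prod>T"
      show "S = T"
      proof (rule Set.set_eqI)
        fix p
        show "p \<in> S \<longleftrightarrow> p \<in> T"
        proof (cases "prime p")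
          case True
          then show ?thesis using dvd_iff[of S p] dvd_iff[of T p] S T e by auto
        qed (use S T pr in blast)
      qed
    qed
    show "Prod ` Pow (prime_factors m) \<subseteq> {d. d dvd m}"
    proof clarsimp
      fix S assume "S \<subseteq> prime_factors m"
      then have "\<Prod>S dvd rad m" unfolding rad_def by (intro prod_dvd_prod_subset) auto
      then show "\<Prod>S dvd m" using rad_dvd[OF m] by (rule dvd_trans)
    qed
    show "finite {d. d dvd m}" using m by simp
  qed
  then show ?thesis by (simp add: card_Pow)
qed

text \<open>The prime 2 is sieved first, with error 1/2. Only the odd prime factors then double the
  error, so the bound involves the divisors of \<open>m\<close> alone, halved when \<open>n\<close>
  is even.\<close>

lemma card_coprime_upto_le:
  fixes m z j :: nat
  assumes m: "odd m"
  defines "n \<equiv> 2 ^ j * m"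
  shows "real (card {l \<in> {1..z}. coprime l n})
    \<le> real z * (real (totient n) / real n) + (if j = 0 then 1 else 1/2) * real (card {d. d dvd m})"
proof -
  have m0: "m > 0" using m by (auto intro: gr0I)
  then have n0: "n > 0" by (simp add: n_def)
  have pf: "prime_factors n = (prime_factors m \<union> (if j = 0 then {} else {2}))"
    using m0 unfolding n_def by (simp add: prime_factors_product prime_factors_power Un_commute prime_prime_factors)
  have two: "2 \<notin> prime_factors m" using m by auto
  have "{l \<in> {1..z}. coprime l n} = {l. 1 \<le> l \<and> real l \<le> real z \<and> (\<forall>p\<in>prime_factors n. \<not> p dvd l)}"
  proof -
    have "coprime l n \<longleftrightarrow> (\<forall>p\<in>prime_factors n. \<not> p dvd l)" for l
    proof
      show "coprime l n \<Longrightarrow> \<forall>p\<in>prime_factors n. \<not> p dvd l"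
        using coprime_common_divisor not_prime_unit by blast
      assume a: "\<forall>p\<in>prime_factors n. \<not> p dvd l"
      show "coprime l n"
      proof (rule ccontr)
        assume "\<not> coprime l n"
        then obtain p where "prime p" "p dvd l" "p dvd n" by (rule not_coprime_obtains_prime)
        with a n0 show False by (auto simp: in_prime_factors_iff)
      qed
    qed
    then show ?thesis by auto
  qed
  then have c: "card {l \<in> {1..z}. coprime l n} = sieve_count (prime_factors n) (real z)"
    by (simp add: sieve_count_def)
  have tot: "real (totient n) / real n = (\<Prod>p\<in>prime_factors n. 1 - 1 / real p)"
    using n0 by (simp add: totient_formula2)
  have "\<bar>real (sieve_count (prime_factors n) (real z)) - real z * (real (totient n) / real n)\<bar>
    \<le> (if j = 0 then 1 else 1/2) * 2 ^ card (prime_factors m)"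
  proof (cases "j = 0")
    case True
    have "\<bar>real (sieve_count {} y) - y * 1\<bar> \<le> 1" if "y \<ge> 0" for y
      using sieve_count_empty[OF that] by simp linarith
    from sieve_count_error_union[OF _ this, where R = "prime_factors m" and y = "real z"]
    show ?thesis using True pf tot by auto
  next
    case False
    from sieve_count_error_union[OF _ sieve_count_error_two, where R = "prime_factors m" and y = "real z"]
    show ?thesis using False two unfolding tot pf by (auto simp: prod.insert mult_ac)
  qed
  also have "\<dots> \<le> (if j = 0 then 1 else 1/2) * real (card {d. d dvd m})"
  proof (rule mult_left_mono)
    have "real (2 ^ card (prime_factors m)) \<le> real (card {d. d dvd m})"
      using two_power_card_prime_factors_le[OF m0] by (rule of_nat_mono)
    then show "2 ^ card (prime_factors m) \<le> real (card {d. d dvd m})" by simp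
  qed simp
  finally show ?thesis unfolding c by linarith
qed

subsection \<open>The average of \<open>\<rho>\<close>\<close>

text \<open>Pairs \<open>(l, q)\<close> are recounted as \<open>(q, l div q)\<close>, with
  \<open>q\<close> now on the outside.\<close>

lemma sum_card_sqfree_coprime_divisors_le:
  "(\<Sum>l=1..y. card (sqfree_coprime_divisors n l))
    \<le> (\<Sum>q\<in>sqfree_upto y. card {l \<in> {1..y div q}. coprime l n})"
proof -
  let ?T = "SIGMA l:{1..y}. sqfree_coprime_divisors n l"
  let ?U = "SIGMA q:sqfree_upto y. {l \<in> {1..y div q}. coprime l n}"
  have fin: "finite (sqfree_coprime_divisors n l)" if "l > 0" for l
    unfolding sqfree_coprime_divisors_def by (rule finite_subset[OF _ finite_divisors_nat[OF that]]) auto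
  have "(\<Sum>l=1..y. card (sqfree_coprime_divisors n l)) = card ?T"
    using fin by (subst card_SigmaI) auto
  also have "\<dots> \<le> card ?U"
  proof (rule card_inj_on_le[where f = "\<lambda>(l, q). (q, l div q)"])
    show "inj_on (\<lambda>(l, q). (q, l div q)) ?T"
    proof (rule inj_onI, clarsimp)
      fix l l' q assume "q \<in> sqfree_coprime_divisors n l" "q \<in> sqfree_coprime_divisors n l'" "l div q = l' div q"
      then show "l = l'"
        unfolding sqfree_coprime_divisors_def by (metis (no_types, lifting) dvd_div_mult_self mem_Collect_eq)
    qed
    show "(\<lambda>(l, q). (q, l div q)) ` ?T \<subseteq> ?U"
    proof (rule image_subsetI)
      fix p assume "p \<in> ?T"
      then obtain l q where p: "p = (l, q)" and l: "1 \<le> l" "l \<le> y"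
        and q: "q dvd l" "squarefree q" "coprime (l div q) n"
        by (auto simp: sqfree_coprime_divisors_def)
      have "q > 0" "q \<le> l" using q(1) l by (auto intro: gr0I dvd_imp_le)
      moreover have "l div q \<le> y div q" using l(2) by (rule div_le_mono)
      moreover have "l div q \<ge> 1" using \<open>q > 0\<close> \<open>q \<le> l\<close> by (simp add: div_greater_zero_iff Suc_le_eq)
      ultimately show "(\<lambda>(l, q). (q, l div q)) p \<in> ?U"
        using q l by (simp add: p sqfree_upto_def)
    qed
    show "finite ?U" by (rule finite_SigmaI) auto
  qed
  also have "card ?U = (\<Sum>q\<in>sqfree_upto y. card {l \<in> {1..y div q}. coprime l n})"
    by (subst card_SigmaI) auto
  finally show ?thesis .
qed

text \<open>The bound of \<open>rho_le\<close> is summed over \<open>d\<close> first, substituting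
  \<open>d = e\<^sup>2 * l\<close>.\<close>

lemma sum_rho_le_sum_divisors:
  fixes D x :: nat assumes D: "D > 0"
  shows "(\<Sum>d=1..x. rho D d)
    \<le> (\<Sum>e | e dvd D. e * (\<Sum>l=1..x div e\<^sup>2. card (sqfree_coprime_divisors (D div e) l)))"
proof -
  let ?g = "\<lambda>e l. e * card (sqfree_coprime_divisors (D div e) l)"
  have finD: "finite {e. e dvd D}" using D by simp
  have "(\<Sum>d=1..x. rho D d) \<le> (\<Sum>d=1..x. \<Sum>e | e dvd D \<and> e\<^sup>2 dvd d. ?g e (d div e\<^sup>2))"
    using D by (intro sum_mono rho_le) auto
  also have "\<dots> = (\<Sum>d=1..x. \<Sum>e | e dvd D. if e\<^sup>2 dvd d then ?g e (d div e\<^sup>2) else 0)"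
  proof (rule sum.cong[OF refl])
    fix d
    show "(\<Sum>e | e dvd D \<and> e\<^sup>2 dvd d. ?g e (d div e\<^sup>2))
      = (\<Sum>e | e dvd D. if e\<^sup>2 dvd d then ?g e (d div e\<^sup>2) else 0)"
      using sum.inter_filter[OF finD, of "\<lambda>e. ?g e (d div e\<^sup>2)" "\<lambda>e. e\<^sup>2 dvd d"] by simp
  qed
  also have "\<dots> = (\<Sum>e | e dvd D. \<Sum>d=1..x. if e\<^sup>2 dvd d then ?g e (d div e\<^sup>2) else 0)"
    by (rule sum.swap)
  also have "\<dots> = (\<Sum>e | e dvd D. \<Sum>l=1..x div e\<^sup>2. ?g e l)"
  proof (rule sum.cong[OF refl])
    fix e assume "e \<in> {e. e dvd D}"
    then have e0: "e\<^sup>2 > 0" using D by (auto intro: gr0I)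
    have "(\<Sum>d=1..x. if e\<^sup>2 dvd d then ?g e (d div e\<^sup>2) else 0) = (\<Sum>d\<in>{d\<in>{1..x}. e\<^sup>2 dvd d}. ?g e (d div e\<^sup>2))"
      by (rule sum.inter_filter[symmetric]) simp
    also have "\<dots> = (\<Sum>l=1..x div e\<^sup>2. ?g e l)"
    proof (rule sum.reindex_bij_witness[where i = "\<lambda>l. e\<^sup>2 * l" and j = "\<lambda>d. d div e\<^sup>2"])
      fix d assume d: "d \<in> {d\<in>{1..x}. e\<^sup>2 dvd d}"
      then have "e\<^sup>2 \<le> d" by (auto intro: dvd_imp_le)
      then show "d div e\<^sup>2 \<in> {1..x div e\<^sup>2}"
        using d e0 by (simp add: div_le_mono Suc_le_eq div_greater_zero_iff)
    next
      fix l assume l: "l \<in> {1..x div e\<^sup>2}"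
      then have "l * e\<^sup>2 \<le> x" using e0 by (simp add: less_eq_div_iff_mult_less_eq)
      then show "e\<^sup>2 * l \<in> {d\<in>{1..x}. e\<^sup>2 dvd d}"
        using l e0 by (simp add: mult.commute Suc_le_eq)
    qed (use e0 in auto)
    finally show "(\<Sum>d=1..x. if e\<^sup>2 dvd d then ?g e (d div e\<^sup>2) else 0) = (\<Sum>l=1..x div e\<^sup>2. ?g e l)" .
  qed
  finally show ?thesis by (simp add: sum_distrib_left)
qed

lemma bij_betw_divisors_two_power_mult:
  fixes K m :: nat assumes m: "odd m"
  shows "bij_betw (\<lambda>(i, e). 2 ^ i * e) ({..K} \<times> {e. e dvd m}) {e. e dvd 2 ^ K * m}"
proof (rule bij_betw_imageI)
  have odd: "odd e" if "e dvd m" for e using m that by auto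
  show "inj_on (\<lambda>(i, e). 2 ^ i * e) ({..K} \<times> {e. e dvd m})"
  proof (rule inj_onI, clarsimp)
    fix i e j e' assume e: "e dvd m" "e' dvd m" and eq: "2 ^ i * e = 2 ^ j * e'"
    have mult: "multiplicity 2 (2 ^ i * e) = i" if "e dvd m" for i e
      using odd[OF that] by (intro multiplicity_decomposeI[OF refl]) auto
    from mult[OF e(1), of i] mult[OF e(2), of j] have "i = j" using eq by simp
    then show "i = j \<and> e = e'" using eq by simp
  qed
  show "(\<lambda>(i, e). 2 ^ i * e) ` ({..K} \<times> {e. e dvd m}) = {e. e dvd 2 ^ K * m}"
  proof (intro equalityI subsetI)
    fix x assume "x \<in> {e. e dvd 2 ^ K * m}"
    then obtain a e where x: "x = a * e" "a dvd 2 ^ K" "e dvd m"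
      using division_decomp by blast
    then obtain i where "i \<le> K" "a = 2 ^ i" using divides_primepow_nat[OF two_is_prime_nat] by blast
    with x show "x \<in> (\<lambda>(i, e). 2 ^ i * e) ` ({..K} \<times> {e. e dvd m})" by auto
  qed (auto intro: mult_dvd_mono le_imp_power_dvd)
qed

text \<open>The numerators are the sieve errors for the divisors \<open>2 ^ i * e\<close>: the
  cofactor is odd only for \<open>i = K\<close>. That the total is exactly 1 removes the power of
  two from the final constant.\<close>

lemma sum_half_powers: "(\<Sum>i\<le>K. (if i = K then 1 else 1/2) / 2 ^ i) = (1::real)"
proof -
  have "(\<Sum>i<K. 1 / 2 / 2 ^ i) = (1 - 1 / 2 ^ K :: real)"
    by (induction K) (auto simp: field_simps)
  moreover have "(\<Sum>i\<le>K. (if i = K then 1 else 1/2) / 2 ^ i) = (\<Sum>i<K. 1 / 2 / 2 ^ i) + (1 / 2 ^ K :: real)"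
    by (simp add: lessThan_Suc_atMost[symmetric])
  ultimately show ?thesis by simp
qed

lemma sum_rho_le:
  fixes K m x :: nat
  assumes m: "odd m" and x: "x \<ge> 1"
  shows "real (\<Sum>d=1..x. rho (2 ^ K * m) d)
    \<le> real x * (6 / pi\<^sup>2 * (ln (real x) + 7/2) + (\<Sum>e | e dvd m. real (card {d. d dvd m div e}) / real e))"
proof -
  let ?D = "2 ^ K * m"
  let ?M = "6 / pi\<^sup>2 * (ln (real x) + 7/2)"
  let ?\<epsilon> = "\<lambda>i. if i = K then 1 else 1/2 :: real"
  let ?t = "\<lambda>e. real (card {d. d dvd m div e})"
  have m0: "m > 0" using m by (auto intro: gr0I)
  then have D0: "?D > 0" by simp
  have M0: "?M \<ge> 0" using x by simp
  define h where "h e = real e * (\<Sum>l=1..x div e\<^sup>2. real (card (sqfree_coprime_divisors (?D div e) l)))" for e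
  \<comment> \<open>The share of one divisor: a main term weighted by its totient, and a sieve error
    paid once for each of at most \<open>x div (2 ^ i * e)\<^sup>2\<close> values of
    \<open>q\<close>.\<close>
  have h: "h (2 ^ i * e) \<le> real x * (?M * (real (totient (?D div (2 ^ i * e))) / real ?D) + ?\<epsilon> i / 2 ^ i * (?t e / real e))"
    if i: "i \<le> K" and e: "e dvd m" for i e
  proof -
    define f where "f = 2 ^ i * e"
    define n where "n = ?D div f"
    define y where "y = x div f\<^sup>2"
    have e0: "e > 0" using e m0 by (auto intro: gr0I)
    then have f0: "f > 0" by (simp add: f_def)
    have n: "n = 2 ^ (K - i) * (m div e)"
    proof -
      have "?D = f * (2 ^ (K - i) * (m div e))"
        using i e by (simp add: f_def power_add[symmetric] mult_ac)
      then show ?thesis using f0 by (simp add: n_def)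
    qed
    have fn: "real f * real n = real ?D"
    proof -
      have "f dvd ?D" using i e unfolding f_def by (intro mult_dvd_mono le_imp_power_dvd)
      then show ?thesis unfolding n_def by (metis dvd_mult_div_cancel of_nat_mult)
    qed
    have od: "odd (m div e)" using m e by (metis dvd_div_mult_self even_mult_iff)
    let ?\<phi> = "real (totient n) / real n"
    have "h f = real f * real (\<Sum>l=1..y. card (sqfree_coprime_divisors n l))"
      by (simp add: h_def y_def n_def)
    also have "\<dots> \<le> real f * real (\<Sum>q\<in>sqfree_upto y. card {l \<in> {1..y div q}. coprime l n})"
      by (intro mult_left_mono of_nat_mono sum_card_sqfree_coprime_divisors_le) simp
    also have "\<dots> \<le> real f * (\<Sum>q\<in>sqfree_upto y. real y * ?\<phi> * (1 / real q) + ?\<epsilon> i * ?t e)"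
      unfolding of_nat_sum
    proof (intro mult_left_mono sum_mono)
      fix q
      have "real (card {l \<in> {1..y div q}. coprime l n}) \<le> real (y div q) * ?\<phi> + (if K - i = 0 then 1 else 1/2) * ?t e"
        using card_coprime_upto_le[OF od, of "y div q" "K - i"] by (simp only: n)
      also have "(if K - i = 0 then 1 else 1/2 :: real) = ?\<epsilon> i" using i by auto
      also have "real (y div q) * ?\<phi> \<le> real y / real q * ?\<phi>"
        by (intro mult_right_mono of_nat_div_le_of_nat) simp
      finally show "real (card {l \<in> {1..y div q}. coprime l n}) \<le> real y * ?\<phi> * (1 / real q) + ?\<epsilon> i * ?t e"
        by (simp add: mult.commute)
    qed simp
    also have "\<dots> = real f * (real y * ?\<phi> * (\<Sum>q\<in>sqfree_upto y. 1 / real q) + real (card (sqfree_upto y)) * (?\<epsilon> i * ?t e))"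
      by (simp only: sum.distrib sum_distrib_left sum_constant)
    also have "\<dots> \<le> real f * (real y * ?\<phi> * ?M + real y * (?\<epsilon> i * ?t e))"
    proof (intro mult_left_mono add_mono mult_right_mono of_nat_mono)
      show "(\<Sum>q\<in>sqfree_upto y. 1 / real q) \<le> ?M"
      \<comment> \<open>\<open>y\<close> vanishes when \<open>f\<^sup>2 > x\<close>; the sum is then
        empty and a logarithm at 0 is avoided.\<close>
      proof (cases "y = 0")
        case True
        then show ?thesis using M0 by (simp add: sqfree_upto_def)
      next
        case False
        have "y \<le> x" by (simp add: y_def)
        then have "6 / pi\<^sup>2 * (ln (real y) + 7/2) \<le> ?M"
          using False by (intro mult_left_mono) auto
        then show ?thesis using sum_inverse_squarefree_le[of y] False by simp
      qed
      show "card (sqfree_upto y) \<le> y"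
      proof -
        have "card (sqfree_upto y) \<le> card {1..y}" by (intro card_mono) (auto simp: sqfree_upto_def)
        then show ?thesis by simp
      qed
    qed auto
    also have "\<dots> = real f * real y * (?\<phi> * ?M + ?\<epsilon> i * ?t e)" by (simp only: distrib_left mult_ac)
    also have "\<dots> \<le> real x / real f * (?\<phi> * ?M + ?\<epsilon> i * ?t e)"
    proof (rule mult_right_mono)
      have "real f * real y \<le> real f * (real x / real (f\<^sup>2))"
        unfolding y_def by (intro mult_left_mono of_nat_div_le_of_nat) simp
      also have "\<dots> = real x / real f" using f0 by (simp add: power2_eq_square)
      finally show "real f * real y \<le> real x / real f" .
      show "0 \<le> ?\<phi> * ?M + ?\<epsilon> i * ?t e" using x by (intro add_nonneg_nonneg mult_nonneg_nonneg) auto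
    qed
    also have "\<dots> = real x * (?M * (real (totient n) / (real f * real n)) + ?\<epsilon> i * ?t e / real f)"
    proof -
      have "u / v * (w / p * q + r) = u * (q * (w / (v * p)) + r / v)" for u v w p q r :: real
        by (simp add: distrib_left add_divide_distrib mult_ac)
      then show ?thesis .
    qed
    also have "?\<epsilon> i * ?t e / real f = ?\<epsilon> i / 2 ^ i * (?t e / real e)" by (simp add: f_def)
    finally show ?thesis unfolding fn by (simp only: f_def n_def)
  qed
  \<comment> \<open>Gauss's identity: the weights of the main terms add up to 1, which makes the
    main term independent of \<open>D\<close>.\<close>
  have tot: "(\<Sum>e | e dvd ?D. real (totient (?D div e))) = real ?D"
  proof -
    have "(\<Sum>e | e dvd ?D. real (totient (?D div e))) = (\<Sum>e | e dvd ?D. real (totient e))"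
      using D0 by (intro sum.reindex_bij_witness[where i = "\<lambda>e. ?D div e" and j = "\<lambda>e. ?D div e"])
        (auto elim!: dvdE)
    also have "\<dots> = real ?D" by (simp flip: of_nat_sum add: totient_divisor_sum)
    finally show ?thesis .
  qed
  note bij = bij_betw_divisors_two_power_mult[OF m, of K]
  have split: "(\<Sum>e | e dvd ?D. g e) = (\<Sum>(i, e)\<in>{..K} \<times> {e. e dvd m}. g (2 ^ i * e))" for g :: "nat \<Rightarrow> real"
    using sum.reindex_bij_betw[OF bij, of g] by (simp add: case_prod_unfold)
  have "real (\<Sum>d=1..x. rho ?D d) \<le> (\<Sum>e | e dvd ?D. h e)"
    using of_nat_mono[OF sum_rho_le_sum_divisors[OF D0, of x], where 'a = real] by (simp only: h_def of_nat_sum of_nat_mult)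
  also have "\<dots> = (\<Sum>(i, e)\<in>{..K} \<times> {e. e dvd m}. h (2 ^ i * e))" by (rule split)
  also have "\<dots> \<le> (\<Sum>(i, e)\<in>{..K} \<times> {e. e dvd m}.
      real x * (?M * (real (totient (?D div (2 ^ i * e))) / real ?D) + ?\<epsilon> i / 2 ^ i * (?t e / real e)))"
    by (rule sum_mono) (use h in auto)
  also have "\<dots> = real x * (?M * ((\<Sum>(i, e)\<in>{..K} \<times> {e. e dvd m}. real (totient (?D div (2 ^ i * e)))) / real ?D)
      + (\<Sum>(i, e)\<in>{..K} \<times> {e. e dvd m}. ?\<epsilon> i / 2 ^ i * (?t e / real e)))"
    by (simp only: sum_distrib_left[symmetric] sum.distrib sum_divide_distrib case_prod_unfold)
  also have "(\<Sum>(i, e)\<in>{..K} \<times> {e. e dvd m}. real (totient (?D div (2 ^ i * e)))) = real ?D"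
    using split[of "\<lambda>e. real (totient (?D div e))"] tot by simp
  also have "(\<Sum>(i, e)\<in>{..K} \<times> {e. e dvd m}. ?\<epsilon> i / 2 ^ i * (?t e / real e))
      = (\<Sum>i\<le>K. ?\<epsilon> i / 2 ^ i) * (\<Sum>e | e dvd m. ?t e / real e)"
    unfolding sum_product by (rule sum.cartesian_product[symmetric])
  also have "\<dots> = (\<Sum>e | e dvd m. ?t e / real e)"
    unfolding sum_half_powers by simp
  finally show ?thesis using D0 by simp
qed

section \<open>Lower bound for the constant \<open>C_Omega\<close>\<close>

lemma sigma_0_eq: "q > 0 \<Longrightarrow> sigma 0 q = real (card {d. d dvd q})"
proof -
  assume "q > 0"
  \<comment> \<open>\<open>r powr 0\<close> is 1 only for nonzero \<open>r\<close>, so the divisors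
    must be positive.\<close>
  then have "sigma 0 q = (\<Sum>d\<in>{d. d dvd q}. 1)"
    unfolding sigma_def by (intro sum.cong) (auto intro!: gr0I)
  then show ?thesis by simp
qed

text \<open>After the divisor counts are moved to the other side, every summand of
  \<open>C_Omega m\<close> stays nonnegative, and the one for \<open>e = 1\<close> alone exceeds
  \<open>21 / pi\<^sup>2\<close>.\<close>

lemma C_Omega_gt:
  fixes m :: nat
  assumes m: "m \<ge> 1" and s: "sigma (-1) m \<le> 4/3"
  shows "6 / pi\<^sup>2 * (7/2) + (\<Sum>e | e dvd m. real (card {d. d dvd m div e}) / real e) < C_Omega m"
proof -
  let ?t = "\<lambda>e. real (card {d. d dvd m div e})"
  let ?w = "\<lambda>e. 4 * ?t e - 3.498 * sigma (-1) (m div e) + 2.664"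
  have fin: "finite {e. e dvd m}" using m by simp
  have quo: "m div e > 0" "m div e dvd m" if "e dvd m" for e
    using that m by (auto elim!: dvdE intro: gr0I)
  have C: "C_Omega m = (\<Sum>e | e dvd m. ?w e / real e)"
    unfolding C_Omega_def sum_distrib_left
  proof (rule sum.cong[OF refl])
    fix e assume "e \<in> {e. e dvd m}"
    then have "sigma 0 (m div e) = ?t e" using quo(1) by (intro sigma_0_eq) auto
    moreover have "2 * (1 / r * (2 * t - 1.749 * u + 1.332)) = (4 * t - 3.498 * u + 2.664) / r" for r t u :: real
    proof -
      have "4 * t - 3.498 * u + 2.664 = 2 * (2 * t - 1.749 * u + 1.332)" by simp
      then show ?thesis by simp
    qed
    ultimately show "2 * (1 / real e * (2 * sigma 0 (m div e) - 1.749 * sigma (- 1) (m div e) + 1.332)) = ?w e / real e"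
      by simp
  qed
  have t1: "?t e \<ge> 1" if "e dvd m" for e
  proof -
    have "card {1::nat} \<le> card {d. d dvd m div e}" using quo(1)[OF that] by (intro card_mono) auto
    then show ?thesis by simp
  qed
  have sle: "sigma (-1) (m div e) \<le> 4/3" if "e dvd m" for e
  proof -
    have "sigma (-1) (m div e) \<le> sigma (-1) m"
      unfolding sigma_def using fin quo[OF that] by (intro sum_mono2) (auto intro: dvd_trans)
    then show ?thesis using s by simp
  qed
  \<comment> \<open>The numerator is at least \<open>3 - 3.498 * 4/3 + 2.664 = 1\<close>.\<close>
  have pos: "(?w e - ?t e) / real e \<ge> 0" if "e dvd m" for e
    using t1[OF that] sle[OF that] by simp
  have "21 / pi\<^sup>2 < 2.166"
  proof -
    have "3.14 * 3.14 \<le> pi * pi" using pi_approx by (intro mult_mono) auto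
    then show ?thesis by (simp add: field_simps power2_eq_square)
  qed
  also have "2.166 \<le> (?w 1 - ?t 1) / real 1"
  \<comment> \<open>The value 2.166 is \<open>3 - 3.498 + 2.664\<close>, attained at
    \<open>m = 1\<close>, where \<open>sigma (-1) m\<close> is exactly 1. For \<open>m > 1\<close>
    the second divisor outweighs the weaker bound 4/3.\<close>
  proof (cases "m = 1")
    case True
    then have "{d. d dvd m} = {1}" by auto
    moreover have "sigma (-1) m = 1" using True by (simp add: sigma_def)
    ultimately show ?thesis by simp
  next
    case False
    have "card {1, m} \<le> card {d. d dvd m}" using fin by (intro card_mono) auto
    then have "?t 1 \<ge> 2" using False by simp
    then show ?thesis using s by simp
  qed
  also have "\<dots> \<le> (\<Sum>e | e dvd m. (?w e - ?t e) / real e)"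
    using fin pos by (intro member_le_sum) auto
  also have "\<dots> = C_Omega m - (\<Sum>e | e dvd m. ?t e / real e)"
    by (simp only: C diff_divide_distrib sum_subtractf)
  finally show ?thesis by simp
qed

subsection \<open>From \<open>\<rho>\<close> to the divisor function\<close>

text \<open>Abel summation as an induction: from \<open>n\<close> to \<open>n + 1\<close> the
  boundary term drops by \<open>S(n) (1/n - 1/(n+1))\<close>, where \<open>S\<close> is the partial
  sum. This is at most \<open>(a ln n + C) / (n+1)\<close>, hence at most a multiple of
  \<open>ln (n+1) - ln n\<close>.\<close>

lemma sum_abel_log_le:
  fixes r :: "nat \<Rightarrow> real" and a C :: real
  assumes S: "\<And>x. x \<ge> 1 \<Longrightarrow> (\<Sum>d=1..x. r d) \<le> real x * (a * ln (real x) + C)"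
    and a: "a \<ge> 0" and C: "C \<ge> 0" and x: "x \<ge> 1"
  shows "(\<Sum>d=1..x. r d / real d) \<le> (\<Sum>d=1..x. r d) / real x + a / 2 * (ln (real x))\<^sup>2 + C * ln (real x)"
  using x
proof (induction x rule: dec_induct)
  case base
  then show ?case by simp
next
  case (step n)
  let ?S = "\<Sum>d=1..n. r d" and ?n = "real n" and ?k = "real (Suc n)"
  have n: "?n \<ge> 1" using step.hyps by simp
  have ln: "1 / ?k \<le> ln ?k - ln ?n"
    using ln_le_minus_one[of "?n / ?k"] n by (simp add: ln_div field_simps)
  have ln0: "ln ?n \<ge> 0" using n by simp
  have lnk: "ln ?n \<le> ln ?k" using n by simp
  have "?S * (1 / ?n - 1 / ?k) = ?S / ?n * (1 / ?k)" using n by (simp add: field_simps)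
  also have "\<dots> \<le> (a * ln ?n + C) * (1 / ?k)"
    using S[OF step.hyps(1)] n by (intro mult_right_mono) (auto simp: field_simps)
  also have "\<dots> \<le> (a * ln ?n + C) * (ln ?k - ln ?n)"
    using ln a C ln0 by (intro mult_left_mono) auto
  also have "\<dots> = a * ln ?n * (ln ?k - ln ?n) + C * (ln ?k - ln ?n)" by (rule distrib_right)
  \<comment> \<open>Replacing \<open>ln n\<close> by the mean of the two logarithms turns the
    product into a difference of squares, which telescopes.\<close>
  also have "a * ln ?n * (ln ?k - ln ?n) \<le> a * ((ln ?k + ln ?n) / 2) * (ln ?k - ln ?n)"
    using a lnk by (intro mult_right_mono mult_left_mono) auto
  also have "\<dots> = a / 2 * ((ln ?k)\<^sup>2 - (ln ?n)\<^sup>2)" by (simp add: power2_eq_square field_simps)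
  finally have "?S * (1 / ?n - 1 / ?k) \<le> a / 2 * ((ln ?k)\<^sup>2 - (ln ?n)\<^sup>2) + C * (ln ?k - ln ?n)" by simp
  then have "?S / ?n \<le> ?S / ?k + a / 2 * ((ln ?k)\<^sup>2 - (ln ?n)\<^sup>2) + C * (ln ?k - ln ?n)"
    by (simp add: right_diff_distrib)
  moreover have "(\<Sum>d=1..Suc n. r d) / ?k = ?S / ?k + r (Suc n) / ?k"
    by (simp add: add_divide_distrib)
  moreover have "(\<Sum>d=1..Suc n. r d / real d) = (\<Sum>d=1..n. r d / real d) + r (Suc n) / ?k" by simp
  ultimately show ?case using step.IH by (simp only: right_diff_distrib)
qed

lemma tau_le_small_divisors:
  assumes "m > 0" shows "tau m \<le> 2 * card {d. d dvd m \<and> d\<^sup>2 \<le> m}"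
proof -
  let ?A = "{d. d dvd m \<and> d\<^sup>2 \<le> m}"
  have finA: "finite ?A" by (rule finite_subset[OF _ finite_divisors_nat[OF assms]]) auto
  have "{d. d dvd m} \<subseteq> ?A \<union> (\<lambda>d. m div d) ` ?A"
  proof
    fix d assume "d \<in> {d. d dvd m}"
    then obtain k where k: "m = d * k" by (auto elim: dvdE)
    show "d \<in> ?A \<union> (\<lambda>d. m div d) ` ?A"
    proof (cases "d \<le> k")
      case True
      then show ?thesis using k by (simp add: power2_eq_square)
    next
      case False
      then have "k \<in> ?A" using k by (simp add: power2_eq_square)
      moreover have "d = m div k" using k assms by simp
      ultimately show ?thesis by blast
    qed
  qed
  then have "card {d. d dvd m} \<le> card (?A \<union> (\<lambda>d. m div d) ` ?A)"
    using finA by (intro card_mono) auto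
  also have "\<dots> \<le> card ?A + card ((\<lambda>d. m div d) ` ?A)" by (rule card_Un_le)
  also have "\<dots> \<le> card ?A + card ?A" using finA by (intro add_left_mono card_image_le)
  finally show ?thesis by (simp add: tau_def)
qed

text \<open>Only divisors up to the square root are kept, at the price of the factor 2. After
  exchanging \<open>m\<close> and \<open>d\<close>, the window of length \<open>L\<close> meets each
  solution class modulo \<open>d\<close> at most \<open>L / d + 1\<close> times.\<close>

lemma sum_tau_le_sum_rho:
  fixes D M L x :: nat
  assumes M: "M > 0" and L: "L > 0"
    and x: "\<And>d m. m < M + L \<Longrightarrow> d\<^sup>2 \<le> m * (m + D) \<Longrightarrow> d \<le> x"
  shows "real (\<Sum>m\<in>{M..<M + L}. tau (m * (m + D))) \<le> 2 * (\<Sum>d=1..x. (real L / real d + 1) * real (rho D d))"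
proof -
  let ?I = "{M..<M + L}"
  have "(\<Sum>m\<in>?I. tau (m * (m + D))) \<le> (\<Sum>m\<in>?I. 2 * card {d\<in>{1..x}. d dvd m * (m + D)})"
  proof (rule sum_mono)
    fix m assume m: "m \<in> ?I"
    then have pos: "m * (m + D) > 0" using M by simp
    have "{d. d dvd m * (m + D) \<and> d\<^sup>2 \<le> m * (m + D)} \<subseteq> {d\<in>{1..x}. d dvd m * (m + D)}"
    proof
      fix d assume d: "d \<in> {d. d dvd m * (m + D) \<and> d\<^sup>2 \<le> m * (m + D)}"
      then have "d > 0" using dvd_pos_nat[OF pos] by blast
      then show "d \<in> {d\<in>{1..x}. d dvd m * (m + D)}" using d x[of m d] m by auto
    qed
    then have "card {d. d dvd m * (m + D) \<and> d\<^sup>2 \<le> m * (m + D)} \<le> card {d\<in>{1..x}. d dvd m * (m + D)}"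
      by (intro card_mono) auto
    then show "tau (m * (m + D)) \<le> 2 * card {d\<in>{1..x}. d dvd m * (m + D)}"
      using tau_le_small_divisors[OF pos] by linarith
  qed
  also have "\<dots> = 2 * (\<Sum>m\<in>?I. card {d\<in>{1..x}. d dvd m * (m + D)})"
    by (rule sum_distrib_left[symmetric])
  also have "(\<Sum>m\<in>?I. card {d\<in>{1..x}. d dvd m * (m + D)}) = (\<Sum>d=1..x. card {m\<in>?I. d dvd m * (m + D)})"
    by (rule sum_multicount_gen) auto
  finally have "real (\<Sum>m\<in>?I. tau (m * (m + D))) \<le> real (2 * (\<Sum>d=1..x. card {m\<in>?I. d dvd m * (m + D)}))"
    by (rule of_nat_mono)
  also have "\<dots> = 2 * (\<Sum>d=1..x. real (card {m\<in>?I. d dvd m * (m + D)}))" by simp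
  also have "\<dots> \<le> 2 * (\<Sum>d=1..x. (real L / real d + 1) * real (rho D d))"
  proof (intro mult_left_mono sum_mono)
    fix d assume "d \<in> {1..x}"
    then have d: "d > 0" by simp
    let ?T = "{m. m < d \<and> d dvd m * (m + D)}"
    have "card {m\<in>?I. d dvd m * (m + D)} \<le> ((L - 1) div d + 1) * card ?T"
    proof (rule card_residues_interval_le[OF d L])
      fix m assume m: "m \<in> {m\<in>?I. d dvd m * (m + D)}"
      have "[(m mod d) * (m mod d + D) = m * (m + D)] (mod d)"
        by (intro cong_mult cong_add) auto
      then have "d dvd (m mod d) * (m mod d + D)" using m cong_dvd_iff[of _ _ d] by blast
      then show "M \<le> m \<and> m < M + L \<and> m mod d \<in> ?T" using m d by simp
    qed simp
    then have "real (card {m\<in>?I. d dvd m * (m + D)}) \<le> real ((L - 1) div d + 1) * real (rho D d)"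
      unfolding rho_def by (simp only: of_nat_mult[symmetric] of_nat_le_iff)
    also have "\<dots> \<le> (real L / real d + 1) * real (rho D d)"
    proof (rule mult_right_mono)
      have "(L - 1) div d \<le> L div d" by (rule div_le_mono) simp
      then have "real ((L - 1) div d) \<le> real (L div d)" by simp
      also have "\<dots> \<le> real L / real d" by (rule of_nat_div_le_of_nat)
      finally show "real ((L - 1) div d + 1) \<le> real L / real d + 1" by simp
    qed simp
    finally show "real (card {m\<in>?I. d dvd m * (m + D)}) \<le> (real L / real d + 1) * real (rho D d)" .
  qed simp
  finally show ?thesis .
qed

theorem theorem3:
  fixes b c N :: int and t \<Omega> :: nat
  assumes "b < c"
    and "even (c - b)"
    and "(c - b)^2 div 4 = 2^t * int (\<Omega>^2)"
    and "even t" and "odd \<Omega>" and "\<Omega> \<ge> 1"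
    and "sigma (-1) \<Omega> \<le> 4/3"
    and "N \<ge> max 1 (c + 1)"
  shows "(let X = sqrt (real_of_int ((N - b) * (N - c)))
          in real (\<Sum>n\<in>{max 1 (c + 1)..N}. tau (nat ((n - b) * (n - c))))
             < 2 * N * (3 / pi^2 * (ln X)^2 + (6 / pi^2 + C_Omega \<Omega>) * ln X + C_Omega \<Omega>)
               + 2 * X * (6 / pi^2 * ln X + C_Omega \<Omega>))"
proof -
  define X where "X = sqrt (real_of_int ((N - b) * (N - c)))"
  define a where "a = 6 / pi\<^sup>2"
  define C where "C = C_Omega \<Omega>"
  \<comment> \<open>The constant that the average of \<open>rho\<close> really has. The gap
    \<open>C' < C\<close> is the source of the strict inequality.\<close>
  define C' where "C' = 6 / pi\<^sup>2 * (7/2) + (\<Sum>e | e dvd \<Omega>. real (card {d. d dvd \<Omega> div e}) / real e)"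
  define s where "s = max 1 (c + 1)"
  \<comment> \<open>With \<open>m = n - c\<close> the product becomes \<open>m * (m + D)\<close>,
    and \<open>n\<close> from \<open>s\<close> to \<open>N\<close> becomes \<open>m\<close> in a
    window of length \<open>L\<close> starting at \<open>M > 0\<close>.\<close>
  define D where "D = nat (c - b)"
  define M where "M = nat (s - c)"
  define L where "L = nat (N - s + 1)"
  define x where "x = nat \<lfloor>X\<rfloor>"
  have s: "s \<ge> 1" "s \<ge> c + 1" "N \<ge> s" using assms(8) by (auto simp: s_def)
  have M0: "M > 0" and L0: "L > 0" and LN: "int L \<le> N" and DD: "int D = c - b"
    and Mc: "int M = s - c" and MN: "int (M + L) = N - c + 1"
    using s assms(1) by (auto simp: M_def L_def D_def)

  \<comment> \<open>Half of \<open>c - b\<close> is the square root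
    \<open>2 ^ (t div 2) * \<Omega>\<close>; doubling it gives the extra 1 in the exponent.\<close>
  have D: "D = 2 ^ (t div 2 + 1) * \<Omega>"
  proof -
    obtain h where h: "c - b = 2 * h" using assms(2) by (elim evenE)
    obtain k where k: "t = 2 * k" using assms(4) by (elim evenE)
    have h0: "h > 0" using h assms(1) by simp
    have "h\<^sup>2 = (2 ^ k * int \<Omega>)\<^sup>2"
      using assms(3) unfolding h k by (simp add: power_mult_distrib power_mult mult.commute power_commutes)
    then have "h = 2 ^ k * int \<Omega>" using h0 by (simp add: power2_eq_iff_nonneg)
    then have "int D = int (2 ^ (t div 2 + 1) * \<Omega>)" using DD h k by simp
    then show ?thesis by (simp only: of_nat_eq_iff)
  qed

  have f1: "(N - b) * (N - c) \<ge> 1"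
  proof -
    have "1 * 1 \<le> (N - b) * (N - c)" using s assms(1) by (intro mult_mono) auto
    then show ?thesis by simp
  qed
  then have fr: "real_of_int ((N - b) * (N - c)) \<ge> 1" by (simp only: of_int_1_le_iff)
  then have X1: "X \<ge> 1" unfolding X_def by (simp only: real_sqrt_ge_1_iff)
  have XX: "X\<^sup>2 = real_of_int ((N - b) * (N - c))"
    unfolding X_def using fr by (intro real_sqrt_pow2) linarith
  have x1: "x \<ge> 1" and xX: "real x \<le> X" using X1 by (auto simp: x_def le_nat_iff)
  have lnx: "ln (real x) \<le> ln X" "0 \<le> ln (real x)" using x1 xX by auto

  have eq: "(\<Sum>n\<in>{s..N}. tau (nat ((n - b) * (n - c)))) = (\<Sum>m\<in>{M..<M + L}. tau (m * (m + D)))"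
  proof (rule sum.reindex_bij_witness[where i = "\<lambda>m. int m + c" and j = "\<lambda>n. nat (n - c)"])
    fix n assume n: "n \<in> {s..N}"
    then have m: "int (nat (n - c)) = n - c" using s by simp
    show "int (nat (n - c)) + c = n" using m by simp
    show "nat (n - c) \<in> {M..<M + L}" using n m Mc MN by auto
    have "int (nat (n - c) * (nat (n - c) + D)) = (n - c) * (n - c + (c - b))"
      by (simp only: of_nat_mult of_nat_add m DD)
    also have "\<dots> = (n - b) * (n - c)" by (simp add: algebra_simps)
    finally have "nat (n - c) * (nat (n - c) + D) = nat ((n - b) * (n - c))" by (metis nat_int)
    then show "tau (nat (n - c) * (nat (n - c) + D)) = tau (nat ((n - b) * (n - c)))" by simp
  next
    fix m assume m: "m \<in> {M..<M + L}"
    then have "int M \<le> int m" "int m < int (M + L)" by auto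
    then show "int m + c \<in> {s..N}" using Mc MN by auto
    show "nat (int m + c - c) = m" by simp
  qed

  \<comment> \<open>On the window \<open>m * (m + D)\<close> is largest at \<open>m = N - c\<close>,
    where it equals \<open>X\<^sup>2\<close>.\<close>
  have small: "d \<le> x" if m: "m < M + L" and d: "d\<^sup>2 \<le> m * (m + D)" for d m
  proof -
    have "int m \<le> N - c" using m MN by auto
    then have "int m * (int m + int D) \<le> (N - c) * (N - c + (c - b))"
      using s assms(1) by (intro mult_mono) (auto simp: DD)
    moreover have "int (d\<^sup>2) \<le> int m * (int m + int D)"
      using of_nat_mono[OF d, where 'a = int] by (simp only: of_nat_mult of_nat_add)
    ultimately have "int (d\<^sup>2) \<le> (N - b) * (N - c)" by (simp add: mult.commute)
    then have "real_of_int (int (d\<^sup>2)) \<le> real_of_int ((N - b) * (N - c))" by (rule of_int_le_iff[THEN iffD2])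
    then have "(real d)\<^sup>2 \<le> X\<^sup>2" by (simp only: XX of_int_of_nat_eq of_nat_power of_int_power)
    then have "real d \<le> X" by (rule power2_le_imp_le) (use X1 in simp)
    then show "d \<le> x" unfolding x_def by (rule le_nat_floor)
  qed

  have CC: "C' < C" unfolding C_def C'_def using assms(6,7) by (rule C_Omega_gt)
  have C0: "C' \<ge> 0" unfolding C'_def by (intro add_nonneg_nonneg sum_nonneg) auto
  have a0: "a > 0" by (simp add: a_def)
  let ?S = "\<lambda>y. \<Sum>d=1..y. real (rho D d)"
  have S': "?S y \<le> real y * (a * ln (real y) + C')" if "y \<ge> 1" for y
    using sum_rho_le[OF assms(5) that, of "t div 2 + 1"]
    unfolding D[symmetric] of_nat_sum C'_def a_def by (simp only: distrib_left add.assoc)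
  have S: "?S y \<le> real y * (a * ln (real y) + C)" if "y \<ge> 1" for y
  proof -
    have "real y * (a * ln (real y) + C') \<le> real y * (a * ln (real y) + C)"
      using CC by (intro mult_left_mono) auto
    with S'[OF that] show ?thesis by linarith
  qed
  have Sx: "?S x / real x < a * ln X + C"
  proof -
    have "?S x / real x \<le> a * ln (real x) + C'" using S'[OF x1] x1 by (simp add: field_simps)
    also have "\<dots> < a * ln X + C" using lnx a0 CC by (intro add_le_less_mono mult_left_mono) auto
    finally show ?thesis .
  qed
  have S2: "?S x < X * (a * ln X + C)"
  proof -
    have "?S x = real x * (?S x / real x)" using x1 by simp
    also have "\<dots> < real x * (a * ln X + C)" using Sx x1 by (intro mult_strict_left_mono) auto
    also have "\<dots> \<le> X * (a * ln X + C)"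
      using xX a0 C0 CC lnx by (intro mult_right_mono add_nonneg_nonneg mult_nonneg_nonneg) auto
    finally show ?thesis .
  qed
  \<comment> \<open>The boundary term \<open>?S x / x\<close> is kept and estimated by the strict
    bound \<open>Sx\<close>, which makes the resulting inequality strict.\<close>
  have "(\<Sum>d=1..x. real (rho D d) / real d)
      \<le> ?S x / real x + a / 2 * (ln (real x))\<^sup>2 + C * ln (real x)"
    by (rule sum_abel_log_le[OF S]) (use a0 C0 CC x1 in auto)
  also have "\<dots> < (a * ln X + C) + a / 2 * (ln X)\<^sup>2 + C * ln X"
    using Sx lnx a0 C0 CC
    by (intro add_less_le_mono mult_left_mono power_mono) auto
  finally have S1: "(\<Sum>d=1..x. real (rho D d) / real d) < a / 2 * (ln X)\<^sup>2 + (a + C) * ln X + C"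
    by (simp add: algebra_simps)

  have "real (\<Sum>n\<in>{s..N}. tau (nat ((n - b) * (n - c))))
      \<le> 2 * (\<Sum>d=1..x. (real L / real d + 1) * real (rho D d))"
    unfolding eq using small by (rule sum_tau_le_sum_rho[OF M0 L0])
  also have "\<dots> = 2 * (real L * (\<Sum>d=1..x. real (rho D d) / real d)) + 2 * ?S x"
    by (simp add: distrib_right sum.distrib sum_distrib_left)
  \<comment> \<open>The window has \<open>N - s + 1 \<le> N\<close> elements since
    \<open>s \<ge> 1\<close>.\<close>
  also have "\<dots> \<le> 2 * (real_of_int N * (\<Sum>d=1..x. real (rho D d) / real d)) + 2 * ?S x"
    using LN by (intro add_right_mono mult_left_mono mult_right_mono sum_nonneg) auto
  also have "\<dots> < 2 * (real_of_int N * (a / 2 * (ln X)\<^sup>2 + (a + C) * ln X + C)) + 2 * (X * (a * ln X + C))"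
    using S1 S2 s by (intro add_strict_mono mult_strict_left_mono) auto
  finally show ?thesis unfolding Let_def X_def[symmetric] s_def[symmetric] C_def[symmetric] a_def
    by (simp add: mult.assoc)
qed

end
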